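(* Let $n,k$ be positive integers such that $k>1$ and $k$ divides $n$, and let $A\in\mathbb{R}^{(n-k+1)\times n}$ and $B\in\mathbb{R}^{n\times n}$ be the matrices of valid and circular convolution with a box of width $k$, respectively. Then: (i) there exist $x\in\mathbb{R}^n$ with $|\operatorname{supp}(x)|=\frac{n}{k}$ and $y=Ax$ such that $x$ is not the unique minimizer of $\|w\|_1$ among all $w\in\mathbb{R}^n$ with $Aw=y$ (i.e. it is not the case that $\|x'\|_1>\|x\|_1$ for all $x'\neq x$ with $Ax'=y$); (ii) there exist $x\in\mathbb{R}^n$ with $|\operatorname{supp}(x)|=\frac{n}{k}$ and $y=Bx$ such that $x$ is not the unique minimizer of $\|w\|_1$ among all $w\in\mathbb{R}^n$ with $Bw=y$ (i.e. it is not the case that $\|x'\|_1>\|x\|_1$ for all $x'\neq x$ with $Bx'=y$).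
   Context: For $x\in\mathbb{R}^n$, $\operatorname{supp}(x)\subseteq\{1,\ldots,n\}$ is the set of indices where $x$ is nonzero, and $\|x\|_1=\sum_{i=1}^n|x_i|$. Valid convolution with a box of width $k$: $A$ is the $(n-k+1)\times n$ matrix with $(Ax)_i=x_i+x_{i+1}+\cdots+x_{i+k-1}$ for $1\le i\le n-k+1$. Circular convolution with a box of width $k$: $B$ is the $n\times n$ matrix with $(Bx)_i=\sum_{t=0}^{k-1}x_{i+t}$ for $1\le i\le n$, where indices are taken modulo $n$ with representatives in $\{1,\ldots,n\}$. (The first $n-k+1$ rows of $B$ are the rows of $A$.) *)

theory Defs
  imports Complex_Main "Jordan_Normal_Form.Matrix"
begin

text \<open>
  Vectors in \<open>\<real>\<^sup>n\<close> are elements of \<^term>\<open>carrier_vec n :: real vec set\<close>. Indices are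
  \<open>0, \<dots>, n - 1\<close> rather than \<open>1, \<dots>, n\<close>.
\<close>

definition supp_vec :: "real vec \<Rightarrow> nat set" where
  "supp_vec x = {i. i < dim_vec x \<and> x $ i \<noteq> 0}"

definition l1_norm_vec :: "real vec \<Rightarrow> real" where
  "l1_norm_vec x = (\<Sum>i<dim_vec x. \<bar>x $ i\<bar>)"

text \<open>Meaningful for \<open>k \<le> n\<close>, so that \<open>n - k\<close> is not truncated.\<close>

definition valid_conv_mat :: "nat \<Rightarrow> nat \<Rightarrow> real mat" where
  "valid_conv_mat n k = mat (n - k + 1) n (\<lambda>(i, j). if i \<le> j \<and> j < i + k then 1 else 0)"

definition circular_conv_mat :: "nat \<Rightarrow> nat \<Rightarrow> real mat" where
  "circular_conv_mat n k = mat n n (\<lambda>(i, j). \<Sum>t<k. if (i + t) mod n = j then 1 else 0)"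

text \<open>The entries above give the convolution formulas:\<close>

lemma valid_conv_mat_mult_vec:
  assumes "k \<le> n" and "x \<in> carrier_vec n" and "i < n - k + 1"
  shows "(valid_conv_mat n k *\<^sub>v x) $ i = (\<Sum>t<k. x $ (i + t))"
proof -
  have "(valid_conv_mat n k *\<^sub>v x) $ i
      = (\<Sum>j\<in>{0..<n}. if i \<le> j \<and> j < i + k then x $ j else 0)"
    using assms
    by (auto simp: valid_conv_mat_def scalar_prod_def intro!: sum.cong)
  also have "\<dots> = (\<Sum>j\<in>{i..<i + k}. x $ j)"
    using assms by (intro sum.mono_neutral_cong_right) auto
  also have "\<dots> = (\<Sum>t<k. x $ (i + t))"
    by (rule sum.reindex_bij_witness[of _ "\<lambda>t. i + t" "\<lambda>j. j - i"]) auto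
  finally show ?thesis .
qed

lemma circular_conv_mat_mult_vec:
  assumes "x \<in> carrier_vec n" and "i < n"
  shows "(circular_conv_mat n k *\<^sub>v x) $ i = (\<Sum>t<k. x $ ((i + t) mod n))"
proof -
  have "(circular_conv_mat n k *\<^sub>v x) $ i
      = (\<Sum>j\<in>{0..<n}. (\<Sum>t<k. if (i + t) mod n = j then 1 else 0) * x $ j)"
    using assms by (simp add: circular_conv_mat_def scalar_prod_def)
  also have "\<dots> = (\<Sum>j\<in>{0..<n}. \<Sum>t<k. if (i + t) mod n = j then x $ j else 0)"
    by (simp add: sum_distrib_right if_distrib[of "\<lambda>c. c * _"] cong: if_cong)
  also have "\<dots> = (\<Sum>t<k. \<Sum>j\<in>{0..<n}. if (i + t) mod n = j then x $ j else 0)"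
    by (rule sum.swap)
  also have "\<dots> = (\<Sum>t<k. x $ ((i + t) mod n))"
    using assms by (intro sum.cong) (auto simp: sum.delta)
  finally show ?thesis .
qed

end

theory Submission
  imports Defs
begin

text \<open>
  Every window of \<open>k\<close> consecutive indices, cyclic or not, meets each residue class modulo \<open>k\<close>
  exactly once. So the indicator vectors of the residue classes \<open>0\<close> and \<open>1\<close> have the same image
  (the all-ones vector) and the same norm \<open>n div k\<close>, and neither is a unique minimizer.
\<close>

definition comb_vec :: "nat \<Rightarrow> nat \<Rightarrow> nat \<Rightarrow> real vec" where
  "comb_vec n k r = vec n (\<lambda>i. of_bool (i mod k = r))"

lemma comb_vec_carrier [simp]: "comb_vec n k r \<in> carrier_vec n"
  by (simp add: comb_vec_def)

lemma dim_comb_vec [simp]: "dim_vec (comb_vec n k r) = n"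
  by (simp add: comb_vec_def)

lemma index_comb_vec [simp]: "i < n \<Longrightarrow> comb_vec n k r $ i = of_bool (i mod k = r)"
  by (simp add: comb_vec_def)

text \<open>Induction on the start \<open>i\<close>. For \<open>i = 0\<close> the window is a full
  set of residues, since \<open>t mod k = t\<close> for \<open>t < k\<close>. Sliding the window by
  one trades \<open>i\<close> for \<open>i + k\<close>, which has the same residue, so the count
  does not change.\<close>

lemma sum_residue_window:
  fixes i k r :: nat
  assumes "r < k"
  shows "(\<Sum>t<k. of_bool ((i + t) mod k = r)) = (1 :: real)"
proof (induction i)
  case 0
  have "(\<Sum>t<k. of_bool (t mod k = r)) = (\<Sum>t<k. if r = t then 1 else (0 :: real))"
    by (intro sum.cong) auto
  then show ?case
    using assms by simp
next
  case (Suc i)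
  let ?f = "\<lambda>t. of_bool ((i + t) mod k = r) :: real"
  \<comment> \<open>The sum over \<open>k + 1\<close> consecutive terms is split at its first and at
    its last term; \<open>?f 0 = ?f k\<close> then cancels.\<close>
  have "?f 0 + (\<Sum>t<k. ?f (Suc t)) = (\<Sum>t<Suc k. ?f t)"
    by (rule sum.lessThan_Suc_shift [symmetric])
  also have "\<dots> = (\<Sum>t<k. ?f t) + ?f k"
    by (rule sum.lessThan_Suc)
  finally have "?f 0 + (\<Sum>t<k. ?f (Suc t)) = (\<Sum>t<k. ?f t) + ?f k" .
  then show ?case
    using Suc by simp
qed

text \<open>As \<open>k\<close> divides \<open>n\<close>, the indices below \<open>n\<close> fall
  into \<open>n div k\<close> disjoint windows of length \<open>k\<close>, and each contributes
  1.\<close>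

lemma l1_norm_comb_vec:
  assumes "k dvd n" and "r < k"
  shows "l1_norm_vec (comb_vec n k r) = real (n div k)"
proof -
  let ?f = "\<lambda>i. of_bool (i mod k = r) :: real"
  have "l1_norm_vec (comb_vec n k r) = (\<Sum>i<(n div k) * k. ?f i)"
    using assms(1) by (simp add: l1_norm_vec_def)
  also have "\<dots> = (\<Sum>m<n div k. \<Sum>i\<in>{m * k..<m * k + k}. ?f i)"
    by (rule sum.nat_group [symmetric])
  also have "\<dots> = (\<Sum>m<n div k. \<Sum>t<k. ?f (m * k + t))"
  proof (rule sum.cong [OF refl])
    fix m
    show "(\<Sum>i\<in>{m * k..<m * k + k}. ?f i) = (\<Sum>t<k. ?f (m * k + t))"
      by (rule sum.reindex_bij_witness[of _ "\<lambda>t. m * k + t" "\<lambda>j. j - m * k"]) auto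
  qed
  also have "\<dots> = real (n div k)"
    by (simp only: sum_residue_window[OF assms(2)]) simp
  finally show ?thesis .
qed

text \<open>A vector with entries in {0, 1} has as many nonzero entries as its norm says, so the
  count above is reused.\<close>

lemma card_supp_comb_vec:
  assumes "k dvd n" and "r < k"
  shows "card (supp_vec (comb_vec n k r)) = n div k"
proof -
  have "supp_vec (comb_vec n k r) = {i \<in> {..<n}. i mod k = r}"
    by (auto simp: supp_vec_def)
  then have "real (card (supp_vec (comb_vec n k r))) = (\<Sum>i<n. of_bool (i mod k = r))"
    by (simp add: Int_def)
  also have "\<dots> = l1_norm_vec (comb_vec n k r)"
    by (simp add: l1_norm_vec_def)
  finally show ?thesis
    using l1_norm_comb_vec[OF assms] by simp
qed

text \<open>For \<open>i < n - k + 1\<close> and \<open>t < k\<close> the index \<open>i + t\<close>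
  stays below \<open>n\<close>, so each row sums over a genuine window.\<close>

lemma valid_conv_comb_vec:
  assumes "k \<le> n" and "r < k"
  shows "valid_conv_mat n k *\<^sub>v comb_vec n k r = vec (n - k + 1) (\<lambda>_. 1)"
proof (rule eq_vecI)
  fix i assume "i < dim_vec (vec (n - k + 1) (\<lambda>_. 1 :: real))"
  then have i: "i < n - k + 1"
    by simp
  have "(valid_conv_mat n k *\<^sub>v comb_vec n k r) $ i = (\<Sum>t<k. of_bool ((i + t) mod k = r))"
    using assms(1) i by (simp add: valid_conv_mat_mult_vec)
  then show "(valid_conv_mat n k *\<^sub>v comb_vec n k r) $ i = vec (n - k + 1) (\<lambda>_. 1) $ i"
    using i by (simp only: sum_residue_window[OF assms(2)] index_vec)
qed (simp add: valid_conv_mat_def)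

text \<open>Wrapping around is harmless: because \<open>k\<close> divides \<open>n\<close>,
  reduction modulo \<open>n\<close> preserves residues modulo \<open>k\<close>.\<close>

lemma circular_conv_comb_vec:
  assumes "k dvd n" and "r < k"
  shows "circular_conv_mat n k *\<^sub>v comb_vec n k r = vec n (\<lambda>_. 1)"
proof (rule eq_vecI)
  fix i assume "i < dim_vec (vec n (\<lambda>_. 1 :: real))"
  then have i: "i < n"
    by simp
  have "(circular_conv_mat n k *\<^sub>v comb_vec n k r) $ i = (\<Sum>t<k. of_bool ((i + t) mod k = r))"
    using assms(1) i by (simp add: circular_conv_mat_mult_vec mod_mod_cancel)
  then show "(circular_conv_mat n k *\<^sub>v comb_vec n k r) $ i = vec n (\<lambda>_. 1) $ i"
    using i by (simp only: sum_residue_window[OF assms(2)] index_vec)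
qed (simp add: circular_conv_mat_def)

theorem theorem2:
  fixes n k :: nat and A B :: "real mat"
  assumes "n > 0" and "k > 1" and "k dvd n"
    and "A = valid_conv_mat n k" and "B = circular_conv_mat n k"
  shows "(\<exists>x\<in>carrier_vec n. \<exists>y. card (supp_vec x) = n div k \<and> y = A *\<^sub>v x \<and>
            \<not> (\<forall>x'\<in>carrier_vec n. x' \<noteq> x \<and> A *\<^sub>v x' = y \<longrightarrow> l1_norm_vec x' > l1_norm_vec x))
       \<and> (\<exists>x\<in>carrier_vec n. \<exists>y. card (supp_vec x) = n div k \<and> y = B *\<^sub>v x \<and>
            \<not> (\<forall>x'\<in>carrier_vec n. x' \<noteq> x \<and> B *\<^sub>v x' = y \<longrightarrow> l1_norm_vec x' > l1_norm_vec x))"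
proof -
  let ?x = "comb_vec n k 0" and ?x' = "comb_vec n k 1"
  have k: "0 < k" "1 < k" "k \<le> n"
    using assms(1-3) by (auto dest: dvd_imp_le)
  have card: "card (supp_vec ?x) = n div k"
    using card_supp_comb_vec[OF assms(3) k(1)] .
  \<comment> \<open>Both norms equal \<open>n div k\<close>; \<open>k > 1\<close> makes 1 an
    admissible residue.\<close>
  have norm: "\<not> l1_norm_vec ?x' > l1_norm_vec ?x"
    using l1_norm_comb_vec[OF assms(3)] k by simp
  \<comment> \<open>The index 0 exists because \<open>n > 0\<close>; there \<open>?x\<close> is 1
    and \<open>?x'\<close> is 0.\<close>
  have "?x' $ 0 \<noteq> ?x $ 0"
    using assms(1) by simp
  then have neq: "?x' \<noteq> ?x"
    by auto
  have A: "A *\<^sub>v ?x' = A *\<^sub>v ?x"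
    using valid_conv_comb_vec[OF k(3)] k assms(4) by simp
  have B: "B *\<^sub>v ?x' = B *\<^sub>v ?x"
    using circular_conv_comb_vec[OF assms(3)] k assms(5) by simp
  \<comment> \<open>One argument serves both parts: \<open>?x'\<close> is a competitor to
    \<open>?x\<close> for any \<open>M\<close> with the same value on both.\<close>
  have "\<exists>x\<in>carrier_vec n. \<exists>y. card (supp_vec x) = n div k \<and> y = M *\<^sub>v x \<and>
      \<not> (\<forall>x'\<in>carrier_vec n. x' \<noteq> x \<and> M *\<^sub>v x' = y \<longrightarrow> l1_norm_vec x' > l1_norm_vec x)"
    if "M *\<^sub>v ?x' = M *\<^sub>v ?x" for M :: "real mat"
  proof (intro bexI[of _ ?x] exI[of _ "M *\<^sub>v ?x"] conjI notI)
    assume "\<forall>x'\<in>carrier_vec n. x' \<noteq> ?x \<and> M *\<^sub>v x' = M *\<^sub>v ?x \<longrightarrow> l1_norm_vec x' > l1_norm_vec ?x"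
    from bspec[OF this comb_vec_carrier[of n k 1]] show False
      using neq norm that by blast
  qed (simp_all add: card)
  from this[OF A] this[OF B] show ?thesis
    by (rule conjI)
qed

end
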